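(* Let $\mathcal{R}$ be a finite valuation ring of order $q^r$, let $\mathcal{E}$ be a set of points in $\mathcal{R}^2$ and $\mathcal{L}$ a set of lines in $\mathcal{R}^2$. Then the number $I(\mathcal{E},\mathcal{L})$ of incidences between $\mathcal{E}$ and $\mathcal{L}$ (pairs $(P,\ell)\in\mathcal{E}\times\mathcal{L}$ with $P\in\ell$) satisfies \[\left|I(\mathcal{E},\mathcal{L})-\frac{|\mathcal{E}||\mathcal{L}|}{q^r}\right|\le q^{(2r-1)/2}\sqrt{|\mathcal{E}||\mathcal{L}|}.\]
   Context: $\mathcal{R}$ is a finite valuation ring: a finite commutative local ring with identity whose ideals are totally ordered by inclusion (a finite chain ring); its residue field has $q$ elements, $q$ an odd prime power, and $|\mathcal{R}|=q^r$; $\mathcal{R}^0$ denotes its set of non-units. A line in $\mathcal{R}^2$ is a set $\{(x,y)\in\mathcal{R}^2\colon ax+by+c=0\}$ with $(a,b,c)\in\mathcal{R}^3\setminus(\mathcal{R}^0)^3$. *)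

theory Defs
  imports Complex_Main "HOL-Algebra.QuotRing" "HOL-Number_Theory.Prime_Powers"
begin

text \<open>
  Existence of a maximal ideal rules out the zero ring, which \<^locale>\<open>cring\<close> alone admits.
\<close>

locale finite_valuation_ring = cring +
  assumes finite_carrier: "finite (carrier R)"
    and local: "\<exists>!M. maximalideal M R"
    and ideals_total: "\<lbrakk>ideal I R; ideal J R\<rbrakk> \<Longrightarrow> I \<subseteq> J \<or> J \<subseteq> I"

text \<open>Only meaningful for a local ring, where the maximal ideal is unique.\<close>

definition residue_field :: "('a, 'b) ring_scheme \<Rightarrow> 'a set ring"
  where "residue_field R = R Quot (THE M. maximalideal M R)"

definition nonunits :: "('a, 'b) ring_scheme \<Rightarrow> 'a set"
  where "nonunits R = carrier R - Units R"

definition line :: "('a, 'b) ring_scheme \<Rightarrow> 'a \<Rightarrow> 'a \<Rightarrow> 'a \<Rightarrow> ('a \<times> 'a) set"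
  where "line R a b c =
    {(x, y) \<in> carrier R \<times> carrier R.
      a \<otimes>\<^bsub>R\<^esub> x \<oplus>\<^bsub>R\<^esub> b \<otimes>\<^bsub>R\<^esub> y \<oplus>\<^bsub>R\<^esub> c = \<zero>\<^bsub>R\<^esub>}"

text \<open>
  Lines are point sets, not coefficient triples: proportional triples give the same line,
  and all triples with \<open>a\<close>, \<open>b\<close> non-units and \<open>c\<close> a unit give the empty set,
  which therefore is a single element of \<open>lines R\<close>.
\<close>

definition lines :: "('a, 'b) ring_scheme \<Rightarrow> ('a \<times> 'a) set set"
  where "lines R =
    {line R a b c | a b c.
      (a, b, c) \<in> (carrier R \<times> carrier R \<times> carrier R)
                - (nonunits R \<times> nonunits R \<times> nonunits R)}"

definition incidences :: "'p set \<Rightarrow> 'p set set \<Rightarrow> nat"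
  where "incidences E L = card {(P, l) \<in> E \<times> L. P \<in> l}"

end

theory Submission
  imports Defs "HOL-Analysis.Convex"
begin

text \<open>
  Let \<open>N = |R|\<close> and let \<open>m = N / q\<close> be the number of non-units. A non-empty line has \<open>N\<close> points,
  a point is on at most \<open>N + m\<close> lines, and, since of two ring elements one divides the other, any
  two points are on at least one common line. So if \<open>H P Q\<close> is the number of lines through \<open>P\<close>
  and \<open>Q\<close>, the matrix \<open>H - J\<close> (\<open>J\<close> all ones) is symmetric with non-negative entries and row sums
  at most \<open>(N + m) N - N\<^sup>2 = N m\<close>. Its quadratic form is therefore at most \<open>N m\<close> times the squared
  norm, and it agrees with that of \<open>H\<close> on functions of sum zero. Applied to the balanced indicator
  function of \<open>E\<close>, this bounds the variance of \<open>|E \<inter> l|\<close> over all lines \<open>l\<close>; the Cauchy-Schwarz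
  inequality over \<open>l \<in> L\<close> concludes. The empty line adds \<open>|E|\<^sup>2 / N\<^sup>2\<close> to the variance, which is
  absorbed because the squared norm of the balanced indicator is \<open>|E| - |E|\<^sup>2 / N\<^sup>2\<close>.
\<close>

section \<open>Second moments of line sums in a finite incidence structure\<close>

lemma sum_line_sums_squared_le:
  fixes f :: "'p \<Rightarrow> real" and k d :: nat
  assumes finX: "finite X" and AX: "A \<subseteq> Pow X"
    and size: "\<And>l. l \<in> A \<Longrightarrow> card l = k"
    and deg: "\<And>P. P \<in> X \<Longrightarrow> card {l \<in> A. P \<in> l} \<le> d"
    and joined: "\<And>P Q. P \<in> X \<Longrightarrow> Q \<in> X \<Longrightarrow> \<exists>l\<in>A. P \<in> l \<and> Q \<in> l"
    and zero: "sum f X = 0"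
  shows "(\<Sum>l\<in>A. (\<Sum>P\<in>l. f P)\<^sup>2) \<le> (real d * real k - real (card X)) * (\<Sum>P\<in>X. (f P)\<^sup>2)"
proof -
  have finA: "finite A" using finX AX finite_subset by blast
  define i where "i l P = (of_bool (P \<in> l) :: real)" for l :: "'p set" and P
  define H where "H P Q = (\<Sum>l\<in>A. i l P * i l Q)" for P Q
  have Hsym: "H P Q = H Q P" for P Q
    by (simp add: H_def mult.commute)
  have sum_i: "(\<Sum>P\<in>l. g P) = (\<Sum>P\<in>X. i l P * g P)" if "l \<in> A" for l and g :: "'p \<Rightarrow> real"
  proof -
    have "(\<Sum>P\<in>X. i l P * g P) = (\<Sum>P\<in>X. if P \<in> l then g P else 0)"
      by (rule sum.cong) (auto simp: i_def)
    also have "\<dots> = (\<Sum>P\<in>X \<inter> l. g P)"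
      by (simp add: sum.inter_restrict finX)
    also have "X \<inter> l = l" using that AX by blast
    finally show ?thesis by simp
  qed
  \<comment> \<open>Double counting: each of the at most \<open>d\<close> lines through
    \<open>P\<close> contributes all its \<open>k\<close> points, \<open>P\<close> itself
    included.\<close>
  have row: "(\<Sum>Q\<in>X. H P Q - 1) \<le> real d * real k - real (card X)" if "P \<in> X" for P
  proof -
    have "(\<Sum>Q\<in>X. H P Q) = (\<Sum>l\<in>A. i l P * (\<Sum>Q\<in>X. i l Q * 1))"
      unfolding H_def by (subst sum.swap) (simp add: sum_distrib_left)
    also have "\<dots> = (\<Sum>l\<in>A. i l P * real k)"
      by (rule sum.cong[OF refl], subst sum_i[symmetric]) (auto simp: size)
    also have "\<dots> = (\<Sum>l\<in>A. i l P) * real k"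
      by (simp add: sum_distrib_right)
    also have "(\<Sum>l\<in>A. i l P) = real (card {l \<in> A. P \<in> l})"
      using finA by (simp add: i_def Int_def)
    also have "\<dots> * real k \<le> real d * real k"
      using deg[OF that] by (intro mult_right_mono) auto
    finally show ?thesis by (simp add: sum_subtractf)
  qed
  \<comment> \<open>The case \<open>P = Q\<close> is covered too, so the diagonal entries are also
    non-negative.\<close>
  have ge1: "H P Q - 1 \<ge> 0" if PQ: "P \<in> X" "Q \<in> X" for P Q
  proof -
    obtain l where l: "l \<in> A" "P \<in> l" "Q \<in> l" using joined[OF PQ] by blast
    have "i l P * i l Q \<le> H P Q"
      unfolding H_def using l finA by (intro member_le_sum) (auto simp: i_def)
    then show ?thesis using l by (simp add: i_def)
  qed
  have "(\<Sum>l\<in>A. (\<Sum>P\<in>l. f P)\<^sup>2) = (\<Sum>l\<in>A. \<Sum>P\<in>X. \<Sum>Q\<in>X. i l P * i l Q * (f P * f Q))"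
    by (rule sum.cong) (auto simp: sum_i power2_eq_square sum_product mult_ac)
  also have "\<dots> = (\<Sum>P\<in>X. \<Sum>l\<in>A. \<Sum>Q\<in>X. i l P * i l Q * (f P * f Q))"
    by (rule sum.swap)
  also have "\<dots> = (\<Sum>P\<in>X. \<Sum>Q\<in>X. H P Q * (f P * f Q))"
    unfolding H_def sum_distrib_right by (intro sum.cong refl sum.swap)
  \<comment> \<open>Splitting off the all-ones matrix is free: its quadratic form is the square of
    \<open>sum f X\<close>, which vanishes.\<close>
  also have "\<dots> = (\<Sum>P\<in>X. \<Sum>Q\<in>X. (H P Q - 1) * (f P * f Q)) + (\<Sum>P\<in>X. \<Sum>Q\<in>X. f P * f Q)"
    by (simp add: sum.distrib[symmetric] algebra_simps)
  also have "(\<Sum>P\<in>X. \<Sum>Q\<in>X. f P * f Q) = 0"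
    using zero by (simp add: sum_product[symmetric])
  \<comment> \<open>The arithmetic-geometric mean inequality on each entry, allowed because the
    weights are non-negative. By symmetry both halves then give the same row sums, so the largest
    row sum bounds the form without any eigenvalue theory.\<close>
  also have "(\<Sum>P\<in>X. \<Sum>Q\<in>X. (H P Q - 1) * (f P * f Q)) + 0
      \<le> (\<Sum>P\<in>X. \<Sum>Q\<in>X. (H P Q - 1) * ((f P)\<^sup>2 / 2 + (f Q)\<^sup>2 / 2))"
  proof -
    have "f P * f Q \<le> (f P)\<^sup>2 / 2 + (f Q)\<^sup>2 / 2" for P Q
      using sum_squares_bound[of "f P" "f Q"] by simp
    then show ?thesis
      by (simp, intro sum_mono mult_left_mono ge1) auto
  qed
  also have "\<dots> = (\<Sum>P\<in>X. \<Sum>Q\<in>X. (H P Q - 1) * ((f P)\<^sup>2 / 2))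
      + (\<Sum>P\<in>X. \<Sum>Q\<in>X. (H P Q - 1) * ((f Q)\<^sup>2 / 2))"
    by (simp add: sum.distrib[symmetric] distrib_left)
  also have "(\<Sum>P\<in>X. \<Sum>Q\<in>X. (H P Q - 1) * ((f Q)\<^sup>2 / 2))
      = (\<Sum>P\<in>X. \<Sum>Q\<in>X. (H P Q - 1) * ((f P)\<^sup>2 / 2))"
    by (subst sum.swap) (simp add: Hsym)
  also have "(\<Sum>P\<in>X. \<Sum>Q\<in>X. (H P Q - 1) * ((f P)\<^sup>2 / 2))
      + (\<Sum>P\<in>X. \<Sum>Q\<in>X. (H P Q - 1) * ((f P)\<^sup>2 / 2))
      = (\<Sum>P\<in>X. (\<Sum>Q\<in>X. H P Q - 1) * (f P)\<^sup>2)"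
    unfolding sum_distrib_right[symmetric] sum.distrib[symmetric]
    by (rule sum.cong) (auto simp: field_simps)
  also have "\<dots> \<le> (\<Sum>P\<in>X. (real d * real k - real (card X)) * (f P)\<^sup>2)"
    by (intro sum_mono mult_right_mono row) auto
  finally show ?thesis by (simp add: sum_distrib_left)
qed

text \<open>The parameters are those of the plane over a ring with \<open>N\<close> elements and
  \<open>m\<close> non-units. The extra term for \<open>{}\<close> is there because a set of lines
  may contain the empty line.\<close>

lemma incidence_variance_le:
  fixes N m :: nat
  assumes finX: "finite X" and AX: "A \<subseteq> Pow X" and EX: "E \<subseteq> X"
    and cardX: "card X = N\<^sup>2" and N: "N > 0" and m: "m > 0"
    and size: "\<And>l. l \<in> A \<Longrightarrow> card l = N"
    and deg: "\<And>P. P \<in> X \<Longrightarrow> card {l \<in> A. P \<in> l} \<le> N + m"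
    and joined: "\<And>P Q. P \<in> X \<Longrightarrow> Q \<in> X \<Longrightarrow> \<exists>l\<in>A. P \<in> l \<and> Q \<in> l"
  shows "(\<Sum>l\<in>insert {} A. (real (card (E \<inter> l)) - real (card E) / N)\<^sup>2) \<le> real N * m * card E"
proof -
  define e where "e = real (card E)"
  define n where "n = real N"
  \<comment> \<open>The density of \<open>E\<close> in \<open>X\<close> is subtracted, so
    \<open>f\<close> sums to zero over \<open>X\<close>, and over a line it sums to the deviation of
    \<open>card (E \<inter> l)\<close> from its expected value \<open>e / n\<close>.\<close>
  define f where "f P = (of_bool (P \<in> E) :: real) - e / n\<^sup>2" for P
  have n: "n > 0" using N by (simp add: n_def)
  have ind: "(\<Sum>P\<in>S. of_bool (P \<in> E)) = real (card (E \<inter> S))" if "finite S" for S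
    using that by (simp add: Int_def conj_commute)
  have finA: "finite A" using finX AX finite_subset by blast
  have zero: "sum f X = 0"
    using n cardX by (simp add: f_def sum_subtractf ind finX EX Int_absorb1 Int_absorb2 e_def n_def)
  have line_sum: "(\<Sum>P\<in>l. f P) = real (card (E \<inter> l)) - e / n" if l: "l \<in> A" for l
  proof -
    have "finite l" using AX finX l finite_subset by blast
    then show ?thesis
      using n size[OF l] by (simp add: f_def sum_subtractf Int_commute n_def power2_eq_square)
  qed
  have "(\<Sum>P\<in>X. (f P)\<^sup>2) = (\<Sum>P\<in>X. of_bool (P \<in> E) * (1 - 2 * e / n\<^sup>2) + (e / n\<^sup>2)\<^sup>2)"
    by (rule sum.cong) (auto simp: f_def power2_eq_square algebra_simps)
  also have "\<dots> = e * (1 - 2 * e / n\<^sup>2) + n\<^sup>2 * (e / n\<^sup>2)\<^sup>2"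
    using cardX by (simp add: sum.distrib sum_distrib_right[symmetric] ind finX EX Int_absorb1 Int_absorb2 e_def n_def)
  also have "\<dots> = e - e\<^sup>2 / n\<^sup>2"
    using n by (simp add: field_simps power2_eq_square)
  finally have norm: "(\<Sum>P\<in>X. (f P)\<^sup>2) = e - e\<^sup>2 / n\<^sup>2" .
  have "(\<Sum>l\<in>A. (real (card (E \<inter> l)) - e / n)\<^sup>2) = (\<Sum>l\<in>A. (\<Sum>P\<in>l. f P)\<^sup>2)"
    by (simp add: line_sum)
  also have "\<dots> \<le> (real (N + m) * real N - real (card X)) * (\<Sum>P\<in>X. (f P)\<^sup>2)"
    by (rule sum_line_sums_squared_le[OF finX AX size deg joined zero])
  also have "\<dots> = n * m * (e - e\<^sup>2 / n\<^sup>2)"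
    unfolding norm by (simp add: cardX n_def power2_eq_square distrib_right)
  finally have main: "(\<Sum>l\<in>A. (real (card (E \<inter> l)) - e / n)\<^sup>2) \<le> n * m * (e - e\<^sup>2 / n\<^sup>2)" .
  have "{} \<notin> A" using size N by fastforce
  then have "(\<Sum>l\<in>insert {} A. (real (card (E \<inter> l)) - e / n)\<^sup>2)
      \<le> e\<^sup>2 / n\<^sup>2 + n * m * (e - e\<^sup>2 / n\<^sup>2)"
    using main finA by (simp add: power_divide)
  also have "\<dots> \<le> n * m * e"
  proof -
    \<comment> \<open>The empty line costs \<open>e\<^sup>2 / n\<^sup>2\<close>, while the norm
      leaves a saving of \<open>n * m\<close> times that amount.\<close>
    have "N * m \<ge> 1" using N m by simp
    then have "n * m \<ge> 1" unfolding n_def by (metis of_nat_1 of_nat_le_iff of_nat_mult)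
    then have "1 * (e\<^sup>2 / n\<^sup>2) \<le> n * m * (e\<^sup>2 / n\<^sup>2)"
      by (intro mult_right_mono) auto
    then show ?thesis by (simp add: right_diff_distrib)
  qed
  finally show ?thesis by (simp add: e_def n_def)
qed

section \<open>Divisibility, non-units and the residue field\<close>

context finite_valuation_ring
begin

text \<open>Comparability of the principal ideals of \<open>a\<close> and \<open>b\<close>; this is
  the form in which the chain condition enters.\<close>

lemma divides_total:
  assumes "a \<in> carrier R" "b \<in> carrier R"
  shows "(\<exists>t\<in>carrier R. a = t \<otimes> b) \<or> (\<exists>t\<in>carrier R. b = t \<otimes> a)"
proof -
  have "PIdl a \<subseteq> PIdl b \<or> PIdl b \<subseteq> PIdl a"
    using assms by (intro ideals_total cgenideal_ideal)
  moreover have "a \<in> PIdl a" "b \<in> PIdl b" using assms cgenideal_self by auto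
  ultimately show ?thesis by (auto simp: cgenideal_def)
qed

lemma nonunits_mult:
  assumes "t \<in> carrier R" "a \<in> nonunits R"
  shows "t \<otimes> a \<in> nonunits R"
proof -
  have a: "a \<in> carrier R" using assms by (simp add: nonunits_def)
  have "a \<in> Units R" if ta: "t \<otimes> a \<in> Units R"
  proof -
    define s where "s = inv (t \<otimes> a) \<otimes> t"
    have s: "s \<in> carrier R" using assms(1) ta by (simp add: s_def)
    moreover have "s \<otimes> a = \<one>" using assms(1) a ta by (simp add: s_def m_assoc)
    moreover from this have "a \<otimes> s = \<one>" using m_comm[OF a s] by simp
    ultimately show ?thesis using a by (auto simp: Units_def)
  qed
  then show ?thesis using assms a by (auto simp: nonunits_def)
qed

text \<open>One summand divides the other, so the sum is a multiple of a non-unit.\<close>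

lemma nonunits_add:
  assumes "a \<in> nonunits R" "b \<in> nonunits R"
  shows "a \<oplus> b \<in> nonunits R"
proof -
  have main: "x \<oplus> y \<in> nonunits R"
    if "y \<in> nonunits R" "t \<in> carrier R" "x = t \<otimes> y" for x y t
  proof -
    have "y \<in> carrier R" using that by (simp add: nonunits_def)
    then have "x \<oplus> y = (t \<oplus> \<one>) \<otimes> y" using that by (simp add: l_distr)
    then show ?thesis using that by (simp add: nonunits_mult)
  qed
  have "a \<in> carrier R" "b \<in> carrier R" using assms by (auto simp: nonunits_def)
  with divides_total[OF this] show ?thesis
    using main[of b _ a] main[of a _ b] assms a_comm by metis
qed

text \<open>If zero were a unit, every ideal would be the whole ring, but a maximal ideal is
  proper.\<close>

lemma zero_nonunit: "\<zero> \<in> nonunits R"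
proof -
  obtain M where "maximalideal M R" using local by blast
  then interpret maximalideal M R .
  have "\<zero> \<notin> Units R"
  proof
    assume "\<zero> \<in> Units R"
    then have "\<one> = \<zero>" using Units_r_inv[of \<zero>] Units_inv_closed[of \<zero>] l_null by metis
    then have "carrier R = M"
      using additive_subgroup.zero_closed[OF is_additive_subgroup] one_imp_carrier by simp
    then show False using I_notcarr by simp
  qed
  then show ?thesis by (simp add: nonunits_def)
qed

lemma ideal_nonunits: "ideal (nonunits R) R"
proof (rule idealI[OF ring_axioms])
  show "subgroup (nonunits R) (add_monoid R)"
  proof (rule group.subgroupI[OF a_group])
    fix a assume a: "a \<in> nonunits R"
    then have "a \<in> carrier R" by (simp add: nonunits_def)
    then have "inv\<^bsub>add_monoid R\<^esub> a = (\<ominus> \<one>) \<otimes> a"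
      by (simp add: a_inv_def[symmetric] l_minus)
    then show "inv\<^bsub>add_monoid R\<^esub> a \<in> nonunits R" using nonunits_mult a by simp
  qed (use zero_nonunit nonunits_add in \<open>auto simp: nonunits_def\<close>)
next
  fix a x assume "a \<in> nonunits R" "x \<in> carrier R"
  then show "x \<otimes> a \<in> nonunits R" "a \<otimes> x \<in> nonunits R"
    using nonunits_mult[of x a] m_comm[of a x] by (auto simp: nonunits_def)
qed

text \<open>A proper ideal contains no unit, so \<open>M\<close> lies in the proper ideal of
  non-units, and maximality forces equality.\<close>

lemma maximalideal_eq_nonunits:
  assumes "maximalideal M R"
  shows "M = nonunits R"
proof -
  interpret maximalideal M R by fact
  have "M \<subseteq> nonunits R"
  proof
    fix x assume x: "x \<in> M"
    have xc: "x \<in> carrier R" using x a_subset by blast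
    have "x \<notin> Units R"
    proof
      assume u: "x \<in> Units R"
      then have "inv x \<otimes> x \<in> M" using x by (intro I_l_closed) auto
      then have "M = carrier R" using u one_imp_carrier by simp
      then show False using I_notcarr by simp
    qed
    then show "x \<in> nonunits R" using xc by (simp add: nonunits_def)
  qed
  moreover have "nonunits R \<noteq> carrier R" "nonunits R \<subseteq> carrier R"
    by (auto simp: nonunits_def)
  ultimately show ?thesis using I_maximal[OF ideal_nonunits] by auto
qed

text \<open>Lagrange's theorem for the additive group, once the maximal ideal is identified with the
  non-units. It yields \<open>m = N / q\<close>.\<close>

lemma card_residue_field_mult_nonunits:
  "card (carrier (residue_field R)) * card (nonunits R) = card (carrier R)"
proof -
  obtain M where M: "maximalideal M R" using local by blast
  then have "(THE M. maximalideal M R) = nonunits R"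
    using local maximalideal_eq_nonunits by (metis the_equality)
  then have "carrier (residue_field R) = rcosets\<^bsub>add_monoid R\<^esub> (nonunits R)"
    by (simp add: residue_field_def FactRing_def A_RCOSETS_def)
  moreover have "subgroup (nonunits R) (add_monoid R)"
    using ideal_nonunits by (simp add: ideal_def additive_subgroup_def)
  ultimately show ?thesis
    using group.lagrange[OF a_group] by (simp add: order_def)
qed

lemma card_nonunits_pos: "card (nonunits R) > 0"
  using zero_nonunit finite_carrier finite_subset[of "nonunits R" "carrier R"]
  by (auto simp: nonunits_def card_gt_0_iff)

section \<open>Counting points on lines and lines through points\<close>

lemma line_scale:
  assumes "u \<in> Units R" "a \<in> carrier R" "b \<in> carrier R" "c \<in> carrier R"
  shows "line R (u \<otimes> a) (u \<otimes> b) (u \<otimes> c) = line R a b c"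
proof -
  have "u \<otimes> a \<otimes> x \<oplus> u \<otimes> b \<otimes> y \<oplus> u \<otimes> c = \<zero> \<longleftrightarrow> a \<otimes> x \<oplus> b \<otimes> y \<oplus> c = \<zero>"
    if xy: "x \<in> carrier R" "y \<in> carrier R" for x y
  proof -
    have u: "u \<in> carrier R" using assms by (simp add: Units_closed)
    have "u \<otimes> a \<otimes> x \<oplus> u \<otimes> b \<otimes> y \<oplus> u \<otimes> c = u \<otimes> (a \<otimes> x \<oplus> b \<otimes> y \<oplus> c)"
      using assms xy u by (simp add: r_distr m_assoc)
    moreover have "u \<otimes> z = \<zero> \<longleftrightarrow> z = \<zero>" if "z \<in> carrier R" for z
      using Units_l_cancel[OF assms(1) that zero_closed] u by simp
    ultimately show ?thesis using assms xy by simp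
  qed
  then show ?thesis by (auto simp: line_def)
qed

lemma line_swap:
  assumes "a \<in> carrier R" "b \<in> carrier R"
  shows "line R a b c = prod.swap ` line R b a c"
  using assms by (auto simp: line_def image_iff a_comm)

lemma line_through:
  assumes "a \<in> carrier R" "b \<in> carrier R" "c \<in> carrier R" "(x, y) \<in> line R a b c"
  shows "c = \<ominus> (a \<otimes> x \<oplus> b \<otimes> y)"
  using assms minus_equality[of c "a \<otimes> x \<oplus> b \<otimes> y"] by (auto simp: line_def a_comm)

lemma card_line_one:
  assumes "a \<in> carrier R" "c \<in> carrier R"
  shows "card (line R a \<one> c) = card (carrier R)"
proof -
  have y: "a \<otimes> x \<oplus> \<one> \<otimes> y \<oplus> c = \<zero> \<longleftrightarrow> y = \<ominus> (a \<otimes> x \<oplus> c)"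
    if "x \<in> carrier R" "y \<in> carrier R" for x y
  proof -
    have "a \<otimes> x \<oplus> \<one> \<otimes> y \<oplus> c = y \<oplus> (a \<otimes> x \<oplus> c)"
      using assms that by (simp add: a_ac)
    then show ?thesis
      using assms that minus_equality[of y "a \<otimes> x \<oplus> c"] by (auto simp: l_neg)
  qed
  \<comment> \<open>The line is the graph of a function of \<open>x\<close>.\<close>
  have "line R a \<one> c = (\<lambda>x. (x, \<ominus> (a \<otimes> x \<oplus> c))) ` carrier R"
    using assms by (auto simp: line_def y image_iff simp del: l_one)
  then show ?thesis by (simp add: card_image inj_on_def)
qed

text \<open>These are exactly the non-empty members of \<open>lines R\<close>.\<close>

definition proper_lines :: "('a \<times> 'a) set set"
  where "proper_lines = {line R a b c | a b c.
    a \<in> carrier R \<and> b \<in> carrier R \<and> c \<in> carrier R \<and> (a \<in> Units R \<or> b \<in> Units R)}"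

text \<open>Scale by the inverse of \<open>b\<close> if it is a unit, otherwise by that of
  \<open>a\<close>. In the second case the remaining coefficient stays a non-unit, which limits the
  directions to \<open>N + m\<close> instead of \<open>2 * N\<close>.\<close>

lemma proper_line_cases:
  assumes "l \<in> proper_lines"
  obtains (slope) t c where "t \<in> carrier R" "c \<in> carrier R" "l = line R t \<one> c"
  | (coslope) t c where "t \<in> nonunits R" "c \<in> carrier R" "l = line R \<one> t c"
proof -
  obtain a b c where l: "l = line R a b c" "a \<in> carrier R" "b \<in> carrier R" "c \<in> carrier R"
    "a \<in> Units R \<or> b \<in> Units R"
    using assms by (auto simp: proper_lines_def)
  show ?thesis
  proof (cases "b \<in> Units R")
    case True
    then have "l = line R (inv b \<otimes> a) \<one> (inv b \<otimes> c)"
      using line_scale[of "inv b" a b c] l by simp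
    then show ?thesis using l True by (intro slope) auto
  next
    case False
    then have "a \<in> Units R" "b \<in> nonunits R" using l by (auto simp: nonunits_def)
    moreover from this have "l = line R \<one> (inv a \<otimes> b) (inv a \<otimes> c)"
      using line_scale[of "inv a" a b c] l by simp
    ultimately show ?thesis using l coslope[of "inv a \<otimes> b" "inv a \<otimes> c"] nonunits_mult[of "inv a" b] by simp
  qed
qed

lemma card_proper_line:
  assumes "l \<in> proper_lines"
  shows "card l = card (carrier R)"
  using assms
proof (cases rule: proper_line_cases)
  case (slope t c)
  then show ?thesis by (simp add: card_line_one)
next
  case (coslope t c)
  then have "t \<in> carrier R" by (simp add: nonunits_def)
  then show ?thesis
    using coslope line_swap[of \<one> t c] by (simp add: card_image card_line_one)
qed

text \<open>In normal form the direction \<open>t\<close> together with the point determines the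
  constant term, so there is at most one line through \<open>P\<close> per direction.\<close>

lemma card_proper_lines_through:
  "card {l \<in> proper_lines. P \<in> l} \<le> card (carrier R) + card (nonunits R)"
proof -
  obtain x y where P: "P = (x, y)" by fastforce
  let ?F = "\<lambda>t. line R t \<one> (\<ominus> (t \<otimes> x \<oplus> \<one> \<otimes> y))" and ?G = "\<lambda>t. line R \<one> t (\<ominus> (\<one> \<otimes> x \<oplus> t \<otimes> y))"
  have fin: "finite (nonunits R)" using finite_carrier by (simp add: nonunits_def)
  have "{l \<in> proper_lines. P \<in> l} \<subseteq> ?F ` carrier R \<union> ?G ` nonunits R"
  proof (intro subsetI, elim CollectE conjE)
    fix l assume "l \<in> proper_lines" and Pl: "P \<in> l"
    then show "l \<in> ?F ` carrier R \<union> ?G ` nonunits R"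
    proof (cases rule: proper_line_cases)
      case (slope t c)
      then have "c = \<ominus> (t \<otimes> x \<oplus> \<one> \<otimes> y)" using Pl P line_through[of t \<one> c x y] by simp
      then show ?thesis using slope by blast
    next
      case (coslope t c)
      then have "c = \<ominus> (\<one> \<otimes> x \<oplus> t \<otimes> y)"
        using Pl P line_through[of \<one> t c x y] by (simp add: nonunits_def)
      then show ?thesis using coslope by blast
    qed
  qed
  then have "card {l \<in> proper_lines. P \<in> l} \<le> card (?F ` carrier R \<union> ?G ` nonunits R)"
    using finite_carrier fin by (intro card_mono) auto
  also have "\<dots> \<le> card (?F ` carrier R) + card (?G ` nonunits R)" by (rule card_Un_le)
  also have "\<dots> \<le> card (carrier R) + card (nonunits R)"
    using finite_carrier fin by (intro add_mono card_image_le)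
  finally show ?thesis .
qed

text \<open>Of the two coordinate differences one divides the other, and the quotient
  \<open>t\<close> serves as slope or inverse slope. The constant term is chosen to make the line
  pass through \<open>P\<close>.\<close>

lemma points_joined:
  assumes P: "P \<in> carrier R \<times> carrier R" and Q: "Q \<in> carrier R \<times> carrier R"
  shows "\<exists>l\<in>proper_lines. P \<in> l \<and> Q \<in> l"
proof -
  obtain x y x' y' where eq: "P = (x, y)" "Q = (x', y')" by (metis surj_pair)
  then have c: "x \<in> carrier R" "y \<in> carrier R" "x' \<in> carrier R" "y' \<in> carrier R"
    using P Q by auto
  \<comment> \<open>In this form the line equation holds trivially at \<open>P\<close>, and at
    \<open>Q\<close> it is the divisibility relation \<open>d\<close>.\<close>
  have on_line: "u \<oplus> \<ominus> t \<otimes> v \<oplus> (t \<otimes> w \<ominus> z) = (u \<ominus> z) \<ominus> t \<otimes> (v \<ominus> w)"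
    if "t \<in> carrier R" "u \<in> carrier R" "v \<in> carrier R" "w \<in> carrier R" "z \<in> carrier R" for t u v w z
    using that by (simp add: minus_eq minus_add r_distr r_minus l_minus a_ac)
  have "(\<exists>t\<in>carrier R. x' \<ominus> x = t \<otimes> (y' \<ominus> y)) \<or> (\<exists>t\<in>carrier R. y' \<ominus> y = t \<otimes> (x' \<ominus> x))"
    using c by (intro divides_total) auto
  then show ?thesis
  proof (elim disjE bexE)
    fix t assume t: "t \<in> carrier R" and d: "x' \<ominus> x = t \<otimes> (y' \<ominus> y)"
    let ?l = "line R \<one> (\<ominus> t) (t \<otimes> y \<ominus> x)"
    have "P \<in> ?l"
      using c t eq on_line[of t x y y x] by (simp add: line_def r_neg minus_eq)
    moreover have "Q \<in> ?l"
      using c t eq on_line[of t x' y' y x] d by (simp add: line_def r_neg minus_eq)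
    moreover have "?l \<in> proper_lines" using c t unfolding proper_lines_def by blast
    ultimately show ?thesis by blast
  next
    fix t assume t: "t \<in> carrier R" and d: "y' \<ominus> y = t \<otimes> (x' \<ominus> x)"
    let ?l = "line R (\<ominus> t) \<one> (t \<otimes> x \<ominus> y)"
    have "P \<in> ?l"
      using c t eq on_line[of t y x x y] by (simp add: line_def r_neg minus_eq a_comm)
    moreover have "Q \<in> ?l"
      using c t eq on_line[of t y' x' x y] d by (simp add: line_def r_neg minus_eq a_comm)
    moreover have "?l \<in> proper_lines" using c t unfolding proper_lines_def by blast
    ultimately show ?thesis by blast
  qed
qed

lemma lines_subset: "lines R \<subseteq> insert {} proper_lines"
proof
  fix l assume "l \<in> lines R"
  then obtain a b c where l: "l = line R a b c" "a \<in> carrier R" "b \<in> carrier R" "c \<in> carrier R"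
    and nu: "\<not> (a \<in> nonunits R \<and> b \<in> nonunits R \<and> c \<in> nonunits R)"
    by (auto simp: lines_def)
  show "l \<in> insert {} proper_lines"
  proof (cases "a \<in> Units R \<or> b \<in> Units R")
    case True
    then show ?thesis using l by (auto simp: proper_lines_def)
  next
    case False
    then have ab: "a \<in> nonunits R" "b \<in> nonunits R" using l by (auto simp: nonunits_def)
    \<comment> \<open>A point on the line would express \<open>c\<close> as a combination of the
      non-units \<open>a\<close> and \<open>b\<close>, making all three coefficients
      non-units.\<close>
    have "p \<notin> l" for p
    proof
      obtain x y where p: "p = (x, y)" by fastforce
      assume "p \<in> l"
      then have xy: "x \<in> carrier R" "y \<in> carrier R" and "c = \<ominus> (a \<otimes> x \<oplus> b \<otimes> y)"
        using l p line_through[of a b c x y] by (auto simp: line_def)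
      then have "c = (\<ominus> x) \<otimes> a \<oplus> (\<ominus> y) \<otimes> b"
        using l by (simp add: minus_add r_minus m_comm)
      then have "c \<in> nonunits R" using xy ab by (simp add: nonunits_add nonunits_mult)
      then show False using nu ab by blast
    qed
    then show ?thesis by blast
  qed
qed

section \<open>From the variance to the incidence bound\<close>

lemma incidence_bound:
  assumes E: "E \<subseteq> carrier R \<times> carrier R" and L: "L \<subseteq> lines R"
  shows "\<bar>real (incidences E L) - real (card E) * real (card L) / card (carrier R)\<bar>
    \<le> sqrt (real (card (carrier R)) * card (nonunits R) * (real (card E) * real (card L)))"
proof -
  let ?X = "carrier R \<times> carrier R" and ?N = "card (carrier R)" and ?m = "card (nonunits R)"
  define g where "g l = real (card (E \<inter> l)) - real (card E) / ?N" for l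
  have finX: "finite ?X" using finite_carrier by simp
  have AX: "proper_lines \<subseteq> Pow ?X" by (auto simp: proper_lines_def line_def)
  have finA: "finite (insert {} proper_lines)" using finX AX finite_subset by blast
  have finE: "finite E" using E finX finite_subset by blast
  have LA: "L \<subseteq> insert {} proper_lines" using L lines_subset by blast
  then have finL: "finite L" using finA finite_subset by blast
  have N: "?N > 0" using finite_carrier zero_closed by (auto simp: card_gt_0_iff)
  \<comment> \<open>Grouping incidences by line turns the discrepancy into a sum of the deviations
    \<open>g l\<close>.\<close>
  have "{(P, l) \<in> E \<times> L. P \<in> l} = prod.swap ` (SIGMA l:L. E \<inter> l)" by force
  then have "incidences E L = card (SIGMA l:L. E \<inter> l)"
    by (simp add: incidences_def card_image)
  also have "\<dots> = (\<Sum>l\<in>L. card (E \<inter> l))" using finL finE by (simp add: card_SigmaI)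
  finally have I: "real (incidences E L) - real (card E) * real (card L) / ?N = (\<Sum>l\<in>L. g l)"
    by (simp add: g_def sum_subtractf)
  \<comment> \<open>Cauchy-Schwarz against the constant function 1. The sum of squares may then be
    extended from \<open>L\<close> to all lines, where the variance bound applies.\<close>
  have "(\<Sum>l\<in>L. g l)\<^sup>2 \<le> (\<Sum>l\<in>L. (g l)\<^sup>2) * card L"
    by (rule sum_squared_le_sum_of_squares)
  also have "\<dots> \<le> (\<Sum>l\<in>insert {} proper_lines. (g l)\<^sup>2) * card L"
    using finA LA by (intro mult_right_mono sum_mono2) auto
  also have "\<dots> \<le> (real ?N * ?m * card E) * card L"
    unfolding g_def
    using incidence_variance_le[OF finX AX E _ N card_nonunits_pos card_proper_line
        card_proper_lines_through points_joined]
    by (intro mult_right_mono) (auto simp: card_cartesian_product power2_eq_square)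
  finally have "(\<Sum>l\<in>L. g l)\<^sup>2 \<le> real ?N * ?m * (real (card E) * real (card L))" by (simp add: mult_ac)
  then have "\<bar>\<Sum>l\<in>L. g l\<bar> \<le> sqrt (real ?N * ?m * (real (card E) * real (card L)))"
    using real_le_rsqrt[of "\<bar>\<Sum>l\<in>L. g l\<bar>"] by simp
  then show ?thesis by (simp add: I)
qed

end

theorem theorem4p2:
  fixes R :: "('a, 'b) ring_scheme"
    and q r :: nat
    and E :: "('a \<times> 'a) set"
    and L :: "('a \<times> 'a) set set"
  assumes "finite_valuation_ring R"
    and "card (carrier (residue_field R)) = q"
    and "primepow q" and "odd q"
    and "card (carrier R) = q ^ r"
    and "E \<subseteq> carrier R \<times> carrier R"
    and "L \<subseteq> lines R"
  shows "\<bar>real (incidences E L) - real (card E) * real (card L) / real q ^ r\<bar>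
           \<le> real q powr ((2 * real r - 1) / 2) * sqrt (real (card E) * real (card L))"
proof -
  interpret finite_valuation_ring R by fact
  have q: "real q > 0" using \<open>odd q\<close> by (auto intro: odd_pos)
  have "real q * card (nonunits R) = real q ^ r"
    using card_residue_field_mult_nonunits assms(2,5) by (metis of_nat_mult of_nat_power)
  \<comment> \<open>The exponent is real, so no truncated subtraction arises at
    \<open>r = 0\<close>. The product \<open>N * m\<close> becomes \<open>q\<close> to the power
    \<open>2 * r - 1\<close>.\<close>
  then have "real (card (nonunits R)) = real q powr (real r - 1)"
    using q by (simp add: powr_diff powr_realpow field_simps)
  then have "real (card (carrier R)) * card (nonunits R) = real q powr (2 * real r - 1)"
    using q assms(5) by (simp add: powr_add[symmetric] flip: powr_realpow)
  moreover have "sqrt (real q powr (2 * real r - 1)) = real q powr ((2 * real r - 1) / 2)"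
    using q by (simp add: powr_half_sqrt[symmetric] powr_powr)
  ultimately show ?thesis
    using incidence_bound[OF assms(6,7)] assms(5) by (simp add: real_sqrt_mult)
qed

end
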